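(* Let $p=2n$, $n\ge1$, $d=2p+2$. Let $\mathcal H^{(\lambda)}(B_{\mu(p)},g_{\mu\nu})$ and $\mathcal O^{(\lambda)}(B_{\mu(p)},g_{\mu\nu})$ be scalar functions depending smoothly on a real parameter $\lambda$ (in an interval containing $0$) such that: (a) $\dfrac{\partial}{\partial\lambda}\mathcal H^{(\lambda)}=\mathcal O^{(\lambda)}$ and $\mathcal O^{(\lambda)}_{[\mu_1\dots\mu_p}H^{(\lambda)}_{\mu_{p+1}\dots\mu_{2p}]}=0$ for every $\lambda$; (b) at $\lambda=0$, $H^{(0)}_{[\mu_1\dots\mu_p}H^{(0)}_{\mu_{p+1}\dots\mu_{2p}]}=B_{[\mu_1\dots\mu_p}B_{\mu_{p+1}\dots\mu_{2p}]}$. Then $H^{(\lambda)}_{[\mu_1\dots\mu_p}H^{(\lambda)}_{\mu_{p+1}\dots\mu_{2p}]}=B_{[\mu_1\dots\mu_p}B_{\mu_{p+1}\dots\mu_{2p}]}$ for every value of $\lambda$. Conversely, if $\mathcal H^{(\lambda)}$ satisfies the latter equation for every $\lambda$, then $\mathcal O^{(\lambda)}:=\partial\mathcal H^{(\lambda)}/\partial\lambda$ satisfies $\mathcal O^{(\lambda)}_{[\mu_1\dots\mu_p}H^{(\lambda)}_{\mu_{p+1}\dots\mu_{2p}]}=0$.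
   Context: $B_{\mu(p)}$ is an arbitrary $p$-form on $d$-dimensional space-time (metric $g_{\mu\nu}$, signature $(-,+,\dots,+)$) with $B_{\mu_1\dots\mu_{p-1}\nu}v^\nu=0$ for a given unit timelike vector $v$. Scalar functions are functions of the full contractions of copies of $B$ with the metric. The derivatives are $p$-forms orthogonal to $v$ defined by $\delta_B\mathcal H=\frac1{p!}\delta B^{\mu_1\dots\mu_p}H_{\mu_1\dots\mu_p}$ and $\delta_B\mathcal O=\frac1{p!}\delta B^{\mu_1\dots\mu_p}\mathcal O_{\mu_1\dots\mu_p}$. Square brackets denote antisymmetrization. The quadratic equation is the condition for PST gauge (Lorentz) invariance of the chiral $p$-form theory with Lagrangian density $\frac1{2p!}E\cdot B-\mathcal H(B,g)$. *)

theory Defs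
  imports "HOL-Analysis.Analysis"
begin

text \<open>
  Everything is algebraic at a single space-time point. \<open>'d\<close> indexes the space-time directions
  and \<open>'q\<close> the index slots of a tensor, so that a covariant tensor of rank \<open>CARD('q)\<close> is the
  array of its components, one for each assignment \<open>\<mu> :: 'q \<Rightarrow> 'd\<close> of directions to slots.
\<close>

type_synonym ('q, 'd) tensor = "real ^ ('q \<Rightarrow> 'd)"

type_synonym 'd metric = "real ^ 'd ^ 'd"


subsection \<open>Metric\<close>

text \<open>Signature \<open>(-,+,\<dots>,+)\<close>: some frame (the columns of \<open>E\<close>) diagonalises \<open>g\<close> accordingly,
  \<open>t\<close> being the label of the timelike frame vector.\<close>

definition lorentzian :: "'d::finite metric \<Rightarrow> bool" where
  "lorentzian g \<longleftrightarrow> transpose g = g \<and>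
     (\<exists>(E :: real ^ 'd ^ 'd) t. invertible E \<and>
        transpose E ** g ** E = (\<chi> i j. if i = j then (if i = t then -1 else 1) else 0))"

definition unit_timelike :: "'d::finite metric \<Rightarrow> real ^ 'd \<Rightarrow> bool" where
  "unit_timelike g v \<longleftrightarrow> (\<Sum>a\<in>UNIV. \<Sum>b\<in>UNIV. g $ a $ b * v $ a * v $ b) = -1"

definition raise_all :: "'d::finite metric \<Rightarrow> ('q::finite, 'd) tensor \<Rightarrow> ('q, 'd) tensor" where
  "raise_all g T = (\<chi> \<mu>. \<Sum>\<nu>\<in>UNIV. (\<Prod>k\<in>UNIV. matrix_inv g $ \<mu> k $ \<nu> k) * T $ \<nu>)"


subsection \<open>Forms and antisymmetrization\<close>

definition is_form :: "('q::finite, 'd::finite) tensor \<Rightarrow> bool" where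
  "is_form T \<longleftrightarrow> (\<forall>\<sigma> \<mu>. \<sigma> permutes UNIV \<longrightarrow> T $ (\<mu> \<circ> \<sigma>) = of_int (sign \<sigma>) * T $ \<mu>)"

definition transverse_forms :: "real ^ 'd::finite \<Rightarrow> ('q::finite, 'd) tensor set" where
  "transverse_forms v =
     {T. is_form T \<and> (\<forall>\<mu> k. (\<Sum>\<nu>\<in>UNIV. T $ (\<mu>(k := \<nu>)) * v $ \<nu>) = 0)}"

definition tensor_prod ::
    "('p::finite, 'd::finite) tensor \<Rightarrow> ('q::finite, 'd) tensor \<Rightarrow> ('p + 'q, 'd) tensor" where
  "tensor_prod S T = (\<chi> \<mu>. S $ (\<lambda>k. \<mu> (Inl k)) * T $ (\<lambda>k. \<mu> (Inr k)))"

definition antisymmetrize :: "('q::finite, 'd::finite) tensor \<Rightarrow> ('q, 'd) tensor" where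
  "antisymmetrize T = (\<chi> \<mu>. (1 / fact CARD('q)) *
     (\<Sum>\<sigma> | \<sigma> permutes UNIV. of_int (sign \<sigma>) * T $ (\<mu> \<circ> \<sigma>)))"


subsection \<open>Scalar functions\<close>

text \<open>The slots of \<open>m\<close> copies of \<open>B\<close> are the pairs \<open>(i, k)\<close> with \<open>i < m\<close>. A full pairing \<open>M\<close>
  lists the pairs of slots contracted with each other; every slot occurs exactly once.\<close>

definition full_pairing :: "nat \<Rightarrow> ((nat \<times> 'q) \<times> (nat \<times> 'q)) set \<Rightarrow> bool" where
  "full_pairing m M \<longleftrightarrow>
     M \<subseteq> ({..<m} \<times> UNIV) \<times> ({..<m} \<times> UNIV) \<and>
     (\<forall>e\<in>M. fst e \<noteq> snd e) \<and>
     (\<forall>s\<in>{..<m} \<times> UNIV. \<exists>!e. e \<in> M \<and> (s = fst e \<or> s = snd e))"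

definition full_contraction ::
    "'d::finite metric \<Rightarrow> ('q::finite, 'd) tensor \<Rightarrow> nat \<times> ((nat \<times> 'q) \<times> (nat \<times> 'q)) set \<Rightarrow> real" where
  "full_contraction g B = (\<lambda>(m, M).
     \<Sum>a \<in> ({..<m} \<times> UNIV) \<rightarrow>\<^sub>E UNIV.
       (\<Prod>i<m. B $ (\<lambda>k. a (i, k))) * (\<Prod>(s, t)\<in>M. matrix_inv g $ a s $ a t))"

text \<open>A function of \<open>B\<close> is only constrained on its domain \<open>U\<close>. The restriction discards the
  arguments \<open>(m, M)\<close> for which \<open>M\<close> is not a full pairing.\<close>

definition scalar_function ::
    "'d::finite metric \<Rightarrow> ('q::finite, 'd) tensor set \<Rightarrow> (('q, 'd) tensor \<Rightarrow> real) \<Rightarrow> bool" where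
  "scalar_function g U f \<longleftrightarrow>
     (\<exists>F. \<forall>B\<in>U. f B = F (restrict (full_contraction g B) {(m, M). full_pairing m M}))"


subsection \<open>Smoothness\<close>

text \<open>Derivatives are taken within \<open>S\<close>, which allows one-sided derivatives at end points of a
  parameter interval and relatively open subsets of a linear subspace. In the latter case
  \<open>f' x w\<close> is determined only for \<open>w\<close> in the subspace, and \<open>f'\<close> may be chosen to factor through a
  projection onto it, so that letting \<open>w\<close> range over all vectors is no restriction.\<close>

primrec Ck_on :: "nat \<Rightarrow> 'a::real_normed_vector set \<Rightarrow> ('a \<Rightarrow> real) \<Rightarrow> bool" where
  "Ck_on 0 S f \<longleftrightarrow> continuous_on S f"
| "Ck_on (Suc k) S f \<longleftrightarrow>
     (\<exists>f'. (\<forall>x\<in>S. (f has_derivative f' x) (at x within S)) \<and> (\<forall>w. Ck_on k S (\<lambda>x. f' x w)))"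

definition smooth_on :: "'a::real_normed_vector set \<Rightarrow> ('a \<Rightarrow> real) \<Rightarrow> bool" where
  "smooth_on S f \<longleftrightarrow> (\<forall>k. Ck_on k S f)"

definition smooth_scalar_family ::
    "'d::finite metric \<Rightarrow> real set \<Rightarrow> ('q::finite, 'd) tensor set
      \<Rightarrow> (real \<Rightarrow> ('q, 'd) tensor \<Rightarrow> real) \<Rightarrow> bool" where
  "smooth_scalar_family g I U f \<longleftrightarrow>
     (\<forall>s\<in>I. scalar_function g U (f s)) \<and> smooth_on (I \<times> U) (\<lambda>(s, B). f s B)"


subsection \<open>Derivative with respect to a form\<close>

definition form_inner ::
    "'d::finite metric \<Rightarrow> ('q::finite, 'd) tensor \<Rightarrow> ('q, 'd) tensor \<Rightarrow> real" where
  "form_inner g S T = (1 / fact CARD('q)) * (\<Sum>\<mu>\<in>UNIV. raise_all g S $ \<mu> * T $ \<mu>)"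

text \<open>Variations are restricted to forms orthogonal to \<open>v\<close>. On these \<open>form_inner g\<close> is positive
  definite when \<open>v\<close> is timelike, so the representing form is unique, and it exists wherever \<open>f\<close> is
  differentiable.\<close>

definition form_deriv ::
    "'d::finite metric \<Rightarrow> real ^ 'd \<Rightarrow> (('q::finite, 'd) tensor \<Rightarrow> real)
      \<Rightarrow> ('q, 'd) tensor \<Rightarrow> ('q, 'd) tensor" where
  "form_deriv g v f B = (THE K. K \<in> transverse_forms v \<and>
     (f has_derivative (\<lambda>\<delta>B. form_inner g \<delta>B K)) (at B within transverse_forms v))"

end

(* On forms orthogonal to v the pairing is nondegenerate, so the derivative K(s) of H(s) with
   respect to B is well defined. Derivatives in s and in B commute for smooth H, hence
   dK/ds is the derivative O(s) of the parameter derivative of H. As p is even, the wedge product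
   of p-forms is commutative, so d/ds (K wedge K) = 2 O wedge K. Both directions follow: a function
   on an interval is constant if its derivative vanishes, and constancy makes it vanish. *)

theory Submission
  imports Defs
begin

subsection \<open>Tensors and forms\<close>

text \<open>\<open>form_deriv\<close> is a definite description relative to a subspace, so it says
  nothing until existence and uniqueness of its value are proved. Both rest on one construction:
  antisymmetrizing, projecting along v in every slot and lowering represents any linear functional
  by a transverse form. Raising, lowering and projecting are all one matrix acting on every slot,
  hence \<open>tensor_act\<close>: compositions and adjoints become products and transposes of
  matrices. Commuting the derivatives is delicate because s may be an end point of \<open>I\<close>,
  and derivatives exist only within \<open>I\<close> and within the subspace. Each component of
  \<open>form_deriv\<close> is therefore written as a derivative along a fixed transverse direction.
  This leaves a real function of two variables, possibly one-sided in s but two-sided in t, where a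
  mean value argument applies.\<close>

definition tensor_act :: "real ^ 'd ^ 'd \<Rightarrow> ('q::finite, 'd::finite) tensor \<Rightarrow> ('q, 'd) tensor" where
  "tensor_act M T = (\<chi> \<mu>. \<Sum>\<nu>\<in>UNIV. (\<Prod>k\<in>UNIV. M $ \<mu> k $ \<nu> k) * T $ \<nu>)"

lemma raise_all_eq_tensor_act: "raise_all g T = tensor_act (matrix_inv g) T"
  by (simp add: raise_all_def tensor_act_def)

lemma sum_prod_UNIV:
  fixes f :: "'q::finite \<Rightarrow> 'd::finite \<Rightarrow> 'a::comm_semiring_1"
  shows "(\<Sum>\<nu>\<in>UNIV. \<Prod>k\<in>UNIV. f k (\<nu> k)) = (\<Prod>k\<in>UNIV. \<Sum>a\<in>UNIV. f k a)"
  by (subst prod_sum_PiE) auto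

text \<open>The sum over all intermediate assignments factorises slot by slot, so each slot carries
  an ordinary matrix product.\<close>

lemma tensor_act_mult: "tensor_act M (tensor_act N T) = tensor_act (M ** N) T"
proof -
  have "(\<Sum>\<nu>\<in>UNIV. (\<Prod>k\<in>UNIV. M $ \<mu> k $ \<nu> k) *
          (\<Sum>\<rho>\<in>UNIV. (\<Prod>k\<in>UNIV. N $ \<nu> k $ \<rho> k) * T $ \<rho>)) =
        (\<Sum>\<rho>\<in>UNIV. (\<Prod>k\<in>UNIV. (M ** N) $ \<mu> k $ \<rho> k) * T $ \<rho>)" for \<mu>
  proof -
    have "(\<Sum>\<nu>\<in>UNIV. (\<Prod>k\<in>UNIV. M $ \<mu> k $ \<nu> k) *
          (\<Sum>\<rho>\<in>UNIV. (\<Prod>k\<in>UNIV. N $ \<nu> k $ \<rho> k) * T $ \<rho>)) =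
        (\<Sum>\<rho>\<in>UNIV. \<Sum>\<nu>\<in>UNIV. (\<Prod>k\<in>UNIV. M $ \<mu> k $ \<nu> k * N $ \<nu> k $ \<rho> k) * T $ \<rho>)"
      by (subst sum.swap) (simp add: sum_distrib_left prod.distrib mult_ac)
    also have "\<dots> = (\<Sum>\<rho>\<in>UNIV. (\<Sum>\<nu>\<in>UNIV. \<Prod>k\<in>UNIV. M $ \<mu> k $ \<nu> k * N $ \<nu> k $ \<rho> k) * T $ \<rho>)"
      by (simp add: sum_distrib_right)
    also have "\<dots> = (\<Sum>\<rho>\<in>UNIV. (\<Prod>k\<in>UNIV. (M ** N) $ \<mu> k $ \<rho> k) * T $ \<rho>)"
      by (subst sum_prod_UNIV) (simp add: matrix_matrix_mult_def)
    finally show ?thesis .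
  qed
  then show ?thesis
    by (simp add: tensor_act_def vec_eq_iff)
qed

lemma tensor_act_one: "tensor_act (mat 1) T = T"
proof -
  have "(\<Prod>k\<in>UNIV. (mat 1 :: real^'b^'b) $ \<mu> k $ \<nu> k) = (if \<nu> = \<mu> then 1 else 0)"
    for \<mu> \<nu> :: "'a \<Rightarrow> 'b"
  proof (cases "\<nu> = \<mu>")
    case False
    then obtain k where "\<mu> k \<noteq> \<nu> k" by (metis ext)
    then show ?thesis
      using False by (auto simp: mat_def intro!: prod_zero)
  qed (simp add: mat_def)
  then show ?thesis
    by (simp add: tensor_act_def vec_eq_iff if_distrib[of "\<lambda>x. x * _"] cong: if_cong)
qed

lemma tensor_act_scaleR: "tensor_act M (c *\<^sub>R T) = c *\<^sub>R tensor_act M T"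
  by (simp add: tensor_act_def vec_eq_iff sum_distrib_left mult_ac)

lemma inner_tensor_act: "inner (tensor_act M S) T = inner S (tensor_act (transpose M) T)"
proof -
  have "inner (tensor_act M S) T =
      (\<Sum>\<mu>\<in>UNIV. \<Sum>\<nu>\<in>UNIV. (\<Prod>k\<in>UNIV. M $ \<mu> k $ \<nu> k) * S $ \<nu> * T $ \<mu>)"
    by (simp add: inner_vec_def tensor_act_def sum_distrib_right)
  also have "\<dots> = inner S (tensor_act (transpose M) T)"
    by (subst sum.swap) (simp add: inner_vec_def tensor_act_def sum_distrib_left transpose_def mult_ac)
  finally show ?thesis .
qed

text \<open>Reduces the metric pairing to the Euclidean inner product of component arrays, for which
  adjoints are transposes.\<close>

lemma form_inner_eq_inner:
  "form_inner g S T = inner (tensor_act (matrix_inv g) S) T / fact CARD('q)"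
  for S :: "('q::finite, 'd::finite) tensor"
  by (simp add: form_inner_def raise_all_eq_tensor_act inner_vec_def)

section \<open>Slot permutations and antisymmetrization\<close>

lemma sum_reindex_permutes:
  fixes f :: "('q::finite \<Rightarrow> 'd::finite) \<Rightarrow> 'a::comm_monoid_add"
  assumes "\<sigma> permutes UNIV"
  shows "(\<Sum>\<nu>\<in>UNIV. f (\<nu> \<circ> \<sigma>)) = (\<Sum>\<nu>\<in>UNIV. f \<nu>)"
proof (rule sum.reindex_bij_witness[where i="\<lambda>\<nu>. \<nu> \<circ> inv \<sigma>" and j="\<lambda>\<nu>. \<nu> \<circ> \<sigma>"])
  show "(\<nu> \<circ> \<sigma>) \<circ> inv \<sigma> = \<nu>" for \<nu> :: "'q \<Rightarrow> 'd"
    by (metis assms comp_assoc comp_id permutes_inv_o(1))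
  show "(\<nu> \<circ> inv \<sigma>) \<circ> \<sigma> = \<nu>" for \<nu> :: "'q \<Rightarrow> 'd"
    by (metis assms comp_assoc comp_id permutes_inv_o(2))
qed auto

lemma permutation_UNIV: "\<sigma> permutes (UNIV :: 'q::finite set) \<Longrightarrow> permutation \<sigma>"
  by (auto simp: permutation_permutes intro: exI[of _ UNIV])

text \<open>The same matrix acts in every slot, so the action commutes with relabelling the
  slots.\<close>

lemma is_form_tensor_act:
  assumes "is_form T"
  shows "is_form (tensor_act M T)"
  unfolding is_form_def
proof (intro allI impI)
  fix \<sigma> :: "'a \<Rightarrow> 'a" and \<mu> :: "'a \<Rightarrow> 'b"
  assume \<sigma>: "\<sigma> permutes UNIV"
  have "tensor_act M T $ (\<mu> \<circ> \<sigma>) =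
      (\<Sum>\<nu>\<in>UNIV. (\<Prod>k\<in>UNIV. M $ \<mu> (\<sigma> k) $ (\<nu> \<circ> \<sigma>) k) * T $ (\<nu> \<circ> \<sigma>))"
    by (subst sum_reindex_permutes[OF \<sigma>, where f="\<lambda>\<nu>. (\<Prod>k\<in>UNIV. M $ \<mu> (\<sigma> k) $ \<nu> k) * T $ \<nu>"])
      (simp add: tensor_act_def)
  also have "\<dots> = (\<Sum>\<nu>\<in>UNIV. (\<Prod>k\<in>UNIV. M $ \<mu> k $ \<nu> k) * (of_int (sign \<sigma>) * T $ \<nu>))"
  proof (intro sum.cong refl arg_cong2[where f="(*)"])
    fix \<nu> :: "'a \<Rightarrow> 'b"
    show "(\<Prod>k\<in>UNIV. M $ \<mu> (\<sigma> k) $ (\<nu> \<circ> \<sigma>) k) = (\<Prod>k\<in>UNIV. M $ \<mu> k $ \<nu> k)"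
      using prod.permute[OF \<sigma>, of "\<lambda>k. M $ \<mu> k $ \<nu> k"] by (simp add: o_def)
    show "T $ (\<nu> \<circ> \<sigma>) = of_int (sign \<sigma>) * T $ \<nu>"
      using assms \<sigma> by (auto simp: is_form_def)
  qed
  also have "\<dots> = of_int (sign \<sigma>) * tensor_act M T $ \<mu>"
    by (simp add: tensor_act_def sum_distrib_left mult_ac)
  finally show "tensor_act M T $ (\<mu> \<circ> \<sigma>) = of_int (sign \<sigma>) * tensor_act M T $ \<mu>" .
qed

text \<open>Permuting the slots of the argument composes each \<sigma> with \<tau> on the right, a
  reindexing of the sum that costs \<open>sign \<tau>\<close>. It serves for the \<tau> that
  exchanges the two factors of a wedge product.\<close>

lemma antisymmetrize_permute:
  fixes T :: "('q::finite, 'd::finite) tensor"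
  assumes \<tau>: "\<tau> permutes UNIV"
  shows "antisymmetrize (\<chi> \<mu>. T $ (\<mu> \<circ> \<tau>)) = of_int (sign \<tau>) *\<^sub>R antisymmetrize T"
proof -
  have "(\<Sum>\<sigma> | \<sigma> permutes UNIV. real_of_int (sign \<sigma>) * T $ (\<mu> \<circ> \<sigma> \<circ> \<tau>)) =
        of_int (sign \<tau>) * (\<Sum>\<sigma> | \<sigma> permutes UNIV. of_int (sign \<sigma>) * T $ (\<mu> \<circ> \<sigma>))" for \<mu>
  proof -
    have "of_int (sign \<tau>) * (\<Sum>\<sigma> | \<sigma> permutes UNIV. of_int (sign \<sigma>) * T $ (\<mu> \<circ> \<sigma>)) =
        of_int (sign \<tau>) * (\<Sum>\<sigma> | \<sigma> permutes UNIV. real_of_int (sign (\<sigma> \<circ> \<tau>)) * T $ (\<mu> \<circ> (\<sigma> \<circ> \<tau>)))"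
      by (subst sum_permutations_compose_right[OF \<tau>]) simp
    also have "\<dots> = (\<Sum>\<sigma> | \<sigma> permutes UNIV. real_of_int (sign \<tau>) *
        (real_of_int (sign (\<sigma> \<circ> \<tau>)) * T $ (\<mu> \<circ> (\<sigma> \<circ> \<tau>))))"
      by (simp add: sum_distrib_left)
    also have "\<dots> = (\<Sum>\<sigma> | \<sigma> permutes UNIV. real_of_int (sign \<sigma>) * T $ (\<mu> \<circ> \<sigma> \<circ> \<tau>))"
    proof (rule sum.cong[OF refl])
      fix \<sigma> :: "'q \<Rightarrow> 'q" assume "\<sigma> \<in> {\<sigma>. \<sigma> permutes UNIV}"
      then have "real_of_int (sign \<tau>) * real_of_int (sign (\<sigma> \<circ> \<tau>)) = real_of_int (sign \<sigma>)"
        using \<tau> by (simp add: sign_compose permutation_UNIV flip: of_int_mult)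
      then show "real_of_int (sign \<tau>) * (real_of_int (sign (\<sigma> \<circ> \<tau>)) * T $ (\<mu> \<circ> (\<sigma> \<circ> \<tau>))) =
          real_of_int (sign \<sigma>) * T $ (\<mu> \<circ> \<sigma> \<circ> \<tau>)"
        by (simp add: comp_assoc flip: mult.assoc)
    qed
    finally show ?thesis ..
  qed
  then show ?thesis
    by (simp add: antisymmetrize_def vec_eq_iff)
qed

text \<open>Here the slots of the result are permuted, so \<tau> is composed with \<sigma> on the
  left.\<close>

lemma is_form_antisymmetrize: "is_form (antisymmetrize T)"
  for T :: "('q::finite, 'd::finite) tensor"
  unfolding is_form_def
proof (intro allI impI)
  fix \<tau> :: "'q \<Rightarrow> 'q" and \<mu> :: "'q \<Rightarrow> 'd"
  assume \<tau>: "\<tau> permutes UNIV"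
  have "of_int (sign \<tau>) * (\<Sum>\<sigma> | \<sigma> permutes UNIV. real_of_int (sign \<sigma>) * T $ (\<mu> \<circ> \<sigma>)) =
      of_int (sign \<tau>) * (\<Sum>\<sigma> | \<sigma> permutes UNIV. real_of_int (sign (\<tau> \<circ> \<sigma>)) * T $ (\<mu> \<circ> (\<tau> \<circ> \<sigma>)))"
    by (subst setum_permutations_compose_left[OF \<tau>]) simp
  also have "\<dots> = (\<Sum>\<sigma> | \<sigma> permutes UNIV. real_of_int (sign \<sigma>) * T $ (\<mu> \<circ> \<tau> \<circ> \<sigma>))"
    unfolding sum_distrib_left
  proof (rule sum.cong[OF refl])
    fix \<sigma> :: "'q \<Rightarrow> 'q" assume "\<sigma> \<in> {\<sigma>. \<sigma> permutes UNIV}"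
    then have "real_of_int (sign \<tau>) * real_of_int (sign (\<tau> \<circ> \<sigma>)) = real_of_int (sign \<sigma>)"
      using \<tau> by (simp add: sign_compose permutation_UNIV flip: of_int_mult)
    then show "real_of_int (sign \<tau>) * (real_of_int (sign (\<tau> \<circ> \<sigma>)) * T $ (\<mu> \<circ> (\<tau> \<circ> \<sigma>))) =
        real_of_int (sign \<sigma>) * T $ (\<mu> \<circ> \<tau> \<circ> \<sigma>)"
      by (simp add: comp_assoc flip: mult.assoc)
  qed
  finally show "antisymmetrize T $ (\<mu> \<circ> \<tau>) = of_int (sign \<tau>) * antisymmetrize T $ \<mu>"
    by (simp add: antisymmetrize_def)
qed

text \<open>Against a form, all permuted copies of \<open>T\<close> contribute equally;
  antisymmetrization is thus the orthogonal projection onto forms.\<close>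

lemma inner_antisymmetrize:
  fixes S T :: "('q::finite, 'd::finite) tensor"
  assumes "is_form S"
  shows "inner S (antisymmetrize T) = inner S T"
proof -
  have *: "(\<Sum>\<mu>\<in>UNIV. S $ \<mu> * (of_int (sign \<sigma>) * T $ (\<mu> \<circ> \<sigma>))) = inner S T"
    if "\<sigma> permutes UNIV" for \<sigma>
  proof -
    have "(\<Sum>\<mu>\<in>UNIV. S $ \<mu> * (of_int (sign \<sigma>) * T $ (\<mu> \<circ> \<sigma>))) =
        (\<Sum>\<mu>\<in>UNIV. S $ (\<mu> \<circ> \<sigma>) * T $ (\<mu> \<circ> \<sigma>))"
      using assms that by (auto simp: is_form_def intro!: sum.cong)
    also have "\<dots> = inner S T"
      by (subst sum_reindex_permutes[OF that, where f="\<lambda>\<mu>. S $ \<mu> * T $ \<mu>"]) (simp add: inner_vec_def)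
    finally show ?thesis .
  qed
  have "inner S (antisymmetrize T) = (1 / fact CARD('q)) * (\<Sum>\<mu>\<in>UNIV. \<Sum>\<sigma> | \<sigma> permutes UNIV.
      S $ \<mu> * (of_int (sign \<sigma>) * T $ (\<mu> \<circ> \<sigma>)))"
    by (simp add: inner_vec_def antisymmetrize_def sum_distrib_left sum_divide_distrib)
  also have "\<dots> = (1 / fact CARD('q)) * (\<Sum>\<sigma> | \<sigma> permutes (UNIV :: 'q set). inner S T)"
    by (subst sum.swap) (simp add: *)
  also have "\<dots> = inner S T"
    by (simp add: card_permutations[of UNIV "CARD('q)"])
  finally show ?thesis .
qed

subsection \<open>Projection onto the transverse forms\<close>

lemma sum_slot_zero:
  fixes F :: "('q::finite \<Rightarrow> 'd::finite) \<Rightarrow> real"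
  assumes "\<And>\<nu>. (\<Sum>a\<in>UNIV. F (\<nu>(k := a))) = 0"
  shows "(\<Sum>\<nu>\<in>UNIV. F \<nu>) = 0"
proof -
  \<comment> \<open>An assignment of the slots other than k is encoded by storing the dummy value
    \<open>undefined\<close> in slot k.\<close>
  have "(\<Sum>\<nu>\<in>UNIV. F \<nu>) = (\<Sum>\<nu>\<in>{\<nu>. \<nu> k = undefined}. \<Sum>a\<in>UNIV. F (\<nu>(k := a)))"
    unfolding sum.cartesian_product
    by (rule sum.reindex_bij_witness[where j="\<lambda>\<nu>. (\<nu>(k := undefined), \<nu> k)"
          and i="\<lambda>(\<nu>, a). \<nu>(k := a)"]) auto
  then show ?thesis using assms by simp
qed

text \<open>Expanding the product over slots gives one term for each set \<open>X\<close> of slots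
  in which the identity is chosen. Unless \<open>X\<close> is everything, some slot of
  \<open>T\<close> is contracted with v and the term vanishes.\<close>

lemma tensor_act_transverse:
  fixes T :: "('q::finite, 'd::finite) tensor"
  assumes "T \<in> transverse_forms v"
  shows "tensor_act (\<chi> a b. (if a = b then 1 else 0) + w $ a * v $ b) T = T"
proof -
  have "(\<Sum>\<nu>\<in>UNIV. (\<Prod>k\<in>UNIV. (if \<mu> k = \<nu> k then 1 else 0) + w $ \<mu> k * v $ \<nu> k) * T $ \<nu>) = T $ \<mu>"
    for \<mu> :: "'q \<Rightarrow> 'd"
  proof -
    let ?d = "\<lambda>\<nu> k. (if \<mu> k = \<nu> k then 1 else 0) :: real"
    let ?F = "\<lambda>X \<nu>. (\<Prod>k\<in>X. ?d \<nu> k) * (\<Prod>k\<in>UNIV - X. w $ \<mu> k * v $ \<nu> k) * T $ \<nu>"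
    have "(\<Sum>\<nu>\<in>UNIV. ?F X \<nu>) = 0" if X: "X \<noteq> UNIV" for X
    proof -
      obtain j where j: "j \<notin> X" using X by auto
      show ?thesis
      proof (rule sum_slot_zero[where k=j])
        fix \<nu> :: "'q \<Rightarrow> 'd"
        have "?F X (\<nu>(j := a)) = (\<Prod>k\<in>X. ?d \<nu> k) *
            ((\<Prod>k\<in>UNIV - X - {j}. w $ \<mu> k * v $ \<nu> k) * w $ \<mu> j) * (T $ (\<nu>(j := a)) * v $ a)" for a
        proof -
          have "(\<Prod>k\<in>X. ?d (\<nu>(j := a)) k) = (\<Prod>k\<in>X. ?d \<nu> k)"
            using j by (intro prod.cong) auto
          moreover have "(\<Prod>k\<in>UNIV - X. w $ \<mu> k * v $ (\<nu>(j := a)) k) =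
              w $ \<mu> j * v $ a * (\<Prod>k\<in>UNIV - X - {j}. w $ \<mu> k * v $ \<nu> k)"
            using j by (subst prod.remove[of _ j]) auto
          ultimately show ?thesis by simp
        qed
        then have "(\<Sum>a\<in>UNIV. ?F X (\<nu>(j := a))) = (\<Prod>k\<in>X. ?d \<nu> k) *
            ((\<Prod>k\<in>UNIV - X - {j}. w $ \<mu> k * v $ \<nu> k) * w $ \<mu> j) *
            (\<Sum>a\<in>UNIV. T $ (\<nu>(j := a)) * v $ a)"
          by (simp only: sum_distrib_left mult.assoc)
        then show "(\<Sum>a\<in>UNIV. ?F X (\<nu>(j := a))) = 0"
          using assms by (simp add: transverse_forms_def)
      qed
    qed
    note zero = this
    have "(\<Sum>X\<in>Pow UNIV. \<Sum>\<nu>\<in>UNIV. ?F X \<nu>) = (\<Sum>X\<in>Pow (UNIV :: 'q set). if X = UNIV then \<Sum>\<nu>\<in>UNIV. ?F UNIV \<nu> else 0)"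
    proof (rule sum.cong[OF refl])
      fix X :: "'q set"
      show "(\<Sum>\<nu>\<in>UNIV. ?F X \<nu>) = (if X = UNIV then \<Sum>\<nu>\<in>UNIV. ?F UNIV \<nu> else 0)"
        using zero[of X] by (cases "X = UNIV") (simp_all only: if_True if_False simp_thms)
    qed
    also have "\<dots> = (\<Sum>\<nu>\<in>UNIV. ?F UNIV \<nu>)" by simp
    also have "\<dots> = tensor_act (mat 1) T $ \<mu>"
      by (simp add: tensor_act_def mat_def)
    also have "\<dots> = T $ \<mu>" by (simp add: tensor_act_one)
    finally show ?thesis
      by (simp add: prod_add sum_distrib_right) (subst sum.swap, simp)
  qed
  then show ?thesis by (simp add: tensor_act_def vec_eq_iff)
qed

text \<open>Contracting slot k of the result with v meets only the matrix factor of that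
  slot.\<close>

lemma tensor_act_in_transverse_forms:
  assumes "is_form T" and "\<And>c. (\<Sum>a\<in>UNIV. M $ a $ c * v $ a) = 0"
  shows "tensor_act M T \<in> transverse_forms v"
proof -
  have "(\<Sum>a\<in>UNIV. tensor_act M T $ (\<mu>(k := a)) * v $ a) = 0" for \<mu> k
  proof -
    have "(\<Sum>a\<in>UNIV. tensor_act M T $ (\<mu>(k := a)) * v $ a) =
        (\<Sum>a\<in>UNIV. \<Sum>\<nu>\<in>UNIV. (\<Prod>j\<in>UNIV - {k}. M $ \<mu> j $ \<nu> j) * T $ \<nu> * (M $ a $ \<nu> k * v $ a))"
    proof -
      have "(\<Prod>j\<in>UNIV. M $ (\<mu>(k := a)) j $ \<nu> j) = M $ a $ \<nu> k * (\<Prod>j\<in>UNIV - {k}. M $ \<mu> j $ \<nu> j)" for a \<nu>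
        by (subst prod.remove[of _ k]) auto
      then show ?thesis
        by (simp add: tensor_act_def sum_distrib_right sum_distrib_left mult_ac del: fun_upd_apply)
    qed
    also have "\<dots> = (\<Sum>\<nu>\<in>UNIV. (\<Prod>j\<in>UNIV - {k}. M $ \<mu> j $ \<nu> j) * T $ \<nu> * (\<Sum>a\<in>UNIV. M $ a $ \<nu> k * v $ a))"
      by (subst sum.swap) (simp add: sum_distrib_left)
    finally show ?thesis using assms by simp
  qed
  then show ?thesis
    using assms by (simp add: transverse_forms_def is_form_tensor_act)
qed

section \<open>The inverse metric and representation of functionals\<close>

lemma lorentzian_imp_invertible:
  fixes g :: "'d::finite metric"
  assumes "lorentzian g"
  shows "invertible g"
proof -
  obtain E :: "real ^ 'd ^ 'd" and t where E: "transpose E ** g ** E =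
      (\<chi> i j. if i = j then (if i = t then -1 else 1) else (0::real))"
    using assms unfolding lorentzian_def by blast
  have "det (transpose E ** g ** E) = (\<Prod>i\<in>UNIV. if i = t then -1 else 1)"
    unfolding E by (subst det_diagonal) auto
  then have "det g \<noteq> 0" by (auto simp: det_mul)
  then show ?thesis by (simp add: invertible_det_nz)
qed

lemma
  assumes "invertible A"
  shows matrix_inv_mult_right: "A ** matrix_inv A = mat 1"
    and matrix_inv_mult_left: "matrix_inv A ** A = mat 1"
  using someI_ex[OF assms[unfolded invertible_def]] by (auto simp: matrix_inv_def)

lemma transpose_matrix_inv:
  fixes A :: "real ^ 'n ^ 'n"
  assumes "invertible A" "transpose A = A"
  shows "transpose (matrix_inv A) = matrix_inv A"
proof -
  have "transpose (matrix_inv A) ** A = mat 1"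
    by (metis assms matrix_inv_mult_right matrix_transpose_mul transpose_mat)
  then show ?thesis
    by (metis assms(1) matrix_inv_mult_right matrix_mul_assoc matrix_mul_lid matrix_mul_rid)
qed

lemma form_inner_commute:
  assumes "lorentzian g"
  shows "form_inner g S T = form_inner g T S"
proof -
  have "transpose (matrix_inv g) = matrix_inv g"
    using assms by (intro transpose_matrix_inv lorentzian_imp_invertible) (auto simp: lorentzian_def)
  then show ?thesis
    by (metis form_inner_eq_inner inner_commute inner_tensor_act)
qed

lemma form_inner_represents:
  fixes g :: "'d::finite metric" and L :: "('q::finite, 'd) tensor"
  assumes g: "lorentzian g" and v: "unit_timelike g v"
  obtains K where "K \<in> transverse_forms v"
    and "\<And>S. S \<in> transverse_forms v \<Longrightarrow> form_inner g S K = inner S L"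
proof -
  \<comment> \<open>\<open>P\<close> is the projection onto the orthogonal complement of \<open>v\<close>; it is self-adjoint for \<open>g\<close>,
    so the representing form is found by projecting, and no positivity is needed.\<close>
  define w where "w = g *v v"
  define P where "P = (\<chi> a b. (if a = b then 1 else 0) + w $ a * v $ b)"
  \<comment> \<open>Transverse forms are fixed by \<open>P\<close> and are forms, so neither the
    adjoint of \<open>P\<close> nor antisymmetrizing changes the pairing of \<open>L\<close> with
    them.\<close>
  define A where "A = tensor_act (transpose P) (antisymmetrize L)"
  \<comment> \<open>Acting with \<open>g\<close> undoes the raising inside
    \<open>form_inner\<close>, and the factorial cancels its normalisation.\<close>
  define K where "K = tensor_act g (fact CARD('q) *\<^sub>R A)"
  have sym: "transpose g = g" and inv: "invertible g"
    using g lorentzian_imp_invertible by (auto simp: lorentzian_def)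
  have symG: "transpose (matrix_inv g) = matrix_inv g"
    by (rule transpose_matrix_inv[OF inv sym])
  have gsym: "g $ a $ b = g $ b $ a" for a b
    using sym by (metis transpose_def vec_lambda_beta)
  have "(\<Sum>a\<in>UNIV. \<Sum>b\<in>UNIV. g $ a $ b * v $ a * v $ b) = (\<Sum>a\<in>UNIV. w $ a * v $ a)"
    by (simp add: w_def matrix_vector_mult_def sum_distrib_left sum_distrib_right mult_ac)
  then have wv: "(\<Sum>a\<in>UNIV. w $ a * v $ a) = -1"
    using v by (simp add: unit_timelike_def)
  \<comment> \<open>Since v squares to -1, the projection has a plus sign in front of the product of
    \<open>w\<close> and \<open>v\<close>.\<close>
  have Pv: "(\<Sum>a\<in>UNIV. P $ a $ c * v $ a) = 0" for c
  proof -
    have "(\<Sum>a\<in>UNIV. P $ a $ c * v $ a) =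
        (\<Sum>a\<in>UNIV. if a = c then v $ a else 0) + (\<Sum>a\<in>UNIV. w $ a * v $ a) * v $ c"
      unfolding sum_distrib_right sum.distrib[symmetric] by (intro sum.cong) (auto simp: P_def algebra_simps)
    then show ?thesis using wv by simp
  qed
  have gP: "g ** transpose P = P ** g"
  proof -
    have 1: "(\<Sum>k\<in>UNIV. g $ a $ k * ((if c = k then 1 else 0) + w $ c * v $ k)) = g $ a $ c + w $ a * w $ c" for a c
    proof -
      have "(\<Sum>k\<in>UNIV. g $ a $ k * ((if c = k then 1 else 0) + w $ c * v $ k)) =
          (\<Sum>k\<in>UNIV. if c = k then g $ a $ k else 0) + (\<Sum>k\<in>UNIV. g $ a $ k * v $ k) * w $ c"
        unfolding sum_distrib_right sum.distrib[symmetric]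
        by (intro sum.cong) (auto simp: algebra_simps)
      then show ?thesis by (simp add: w_def matrix_vector_mult_def)
    qed
    have 2: "(\<Sum>k\<in>UNIV. ((if a = k then 1 else 0) + w $ a * v $ k) * g $ k $ c) = g $ a $ c + w $ a * w $ c" for a c
      by (subst gsym)
        (use 1[of c a] in \<open>simp add: mult.commute gsym[of c a]\<close>)
    show ?thesis
      unfolding matrix_matrix_mult_def vec_eq_iff P_def transpose_def
      using 1 2 by simp
  qed
  have "tensor_act P S = S" if "S \<in> transverse_forms v" for S :: "('q, 'd) tensor"
    unfolding P_def by (rule tensor_act_transverse[OF that])
  note PS = this
  have "inner S A = inner S L" if "S \<in> transverse_forms v" for S
    using that PS[OF that]
    by (simp add: A_def inner_antisymmetrize transverse_forms_def flip: inner_tensor_act)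
  note SA = this
  show thesis
  proof
    show "form_inner g S K = inner S L" if "S \<in> transverse_forms v" for S
      using SA[OF that]
      by (simp add: K_def form_inner_eq_inner inner_tensor_act symG tensor_act_scaleR tensor_act_mult
          matrix_inv_mult_left[OF inv] tensor_act_one)
    \<comment> \<open>Moving the projection past the lowering puts it outermost, where it makes the
      result transverse.\<close>
    have "K = tensor_act P (tensor_act g (fact CARD('q) *\<^sub>R antisymmetrize L))"
      by (simp add: K_def A_def tensor_act_scaleR tensor_act_mult gP)
    moreover have "is_form (fact CARD('q) *\<^sub>R antisymmetrize L)"
      using is_form_antisymmetrize[of L] by (simp add: is_form_def)
    ultimately show "K \<in> transverse_forms v"
      by (simp add: tensor_act_in_transverse_forms is_form_tensor_act Pv)
  qed
qed

subsection \<open>The derivative with respect to a form\<close>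

lemma subspace_transverse_forms: "subspace (transverse_forms v)"
  unfolding subspace_def transverse_forms_def is_form_def
  by (auto simp: algebra_simps sum.distrib simp flip: sum_distrib_left)

lemma bounded_linear_form_inner_right: "bounded_linear (form_inner g S)"
  unfolding form_inner_eq_inner[abs_def]
  by (intro bounded_linear_inner_right bounded_linear_compose[OF bounded_linear_divide])

text \<open>Smoothness is given within \<open>U\<close>, whereas \<open>form_deriv\<close>
  differentiates within the whole subspace; relative openness reconciles the two.\<close>

lemma at_within_openin:
  assumes "openin (top_of_set W) U" "x \<in> U"
  shows "at x within U = at x within W"
proof -
  obtain T where T: "open T" "U = W \<inter> T"
    using assms by (auto simp: openin_open)
  show ?thesis
    by (rule at_within_nhd[of x T]) (use T assms in auto)
qed

lemma openin_subspace_line: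
  fixes W :: "'a::real_normed_vector set"
  assumes "subspace W" "openin (top_of_set W) U" "B \<in> U" "h \<in> W"
  obtains e where "e > 0" "\<And>t::real. \<bar>t\<bar> < e \<Longrightarrow> B + t *\<^sub>R h \<in> U"
proof -
  obtain T where T: "open T" "U = W \<inter> T"
    using assms by (auto simp: openin_open)
  have "continuous_on UNIV (\<lambda>t::real. B + t *\<^sub>R h)"
    by (intro continuous_intros)
  then have "open ((\<lambda>t::real. B + t *\<^sub>R h) -` T)"
    using T by (simp add: open_vimage)
  moreover have "0 \<in> (\<lambda>t::real. B + t *\<^sub>R h) -` T"
    using T assms by simp
  ultimately obtain e where "e > 0" "ball 0 e \<subseteq> (\<lambda>t::real. B + t *\<^sub>R h) -` T"
    by (metis open_contains_ball)
  moreover have "B + t *\<^sub>R h \<in> W" for t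
    using assms T by (auto intro: subspace_add subspace_scale)
  ultimately show thesis
    using that[of e] T by (auto simp: subset_iff)
qed

text \<open>A segment inside \<open>S\<close> yields an ordinary two-sided derivative in t. This
  serves both for \<open>S\<close> the transverse subspace and for \<open>S\<close> the product
  \<open>I \<times> U\<close> with direction \<open>(0, h)\<close>.\<close>

lemma has_derivative_within_line:
  assumes "(f has_derivative f') (at (x + t0 *\<^sub>R w) within S)"
    and "\<bar>t0\<bar> < e" "\<And>t::real. \<bar>t\<bar> < e \<Longrightarrow> x + t *\<^sub>R w \<in> S"
  shows "((\<lambda>t. f (x + t *\<^sub>R w)) has_real_derivative f' w) (at t0)"
proof -
  have "((\<lambda>t. x + t *\<^sub>R w) has_derivative (\<lambda>t. t *\<^sub>R w)) (at t0 within {-e<..<e})"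
    by (auto intro!: derivative_eq_intros)
  moreover have "(f has_derivative f') (at (x + t0 *\<^sub>R w) within (\<lambda>t. x + t *\<^sub>R w) ` {-e<..<e})"
    by (rule has_derivative_subset[OF assms(1)]) (use assms(3) in \<open>auto simp: abs_less_iff\<close>)
  ultimately have "((\<lambda>t. f (x + t *\<^sub>R w)) has_derivative (\<lambda>t. f' (t *\<^sub>R w))) (at t0 within {-e<..<e})"
    by (rule has_derivative_in_compose)
  moreover have "(\<lambda>t. f' (t *\<^sub>R w)) = (*) (f' w)"
    using has_derivative_linear[OF assms(1)] by (auto simp: linear_scale mult.commute)
  moreover have "at t0 within {-e<..<e} = at t0"
    using assms(2) by (intro at_within_open) auto
  ultimately show ?thesis by (simp add: has_field_derivative_def)
qed

text \<open>Uniqueness follows from existence: any array is represented by some transverse form, and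
  by symmetry of the pairing, testing with that form compares \<open>K\<close> and \<open>L\<close>
  against the array.\<close>

lemma transverse_forms_eqI:
  fixes g :: "'d::finite metric" and K L :: "('q::finite, 'd) tensor"
  assumes "lorentzian g" "unit_timelike g v"
    and "K \<in> transverse_forms v" "L \<in> transverse_forms v"
    and "\<And>S. S \<in> transverse_forms v \<Longrightarrow> form_inner g S K = form_inner g S L"
  shows "K = L"
proof -
  have "inner K X = inner L X" for X
  proof -
    obtain S where "S \<in> transverse_forms v"
      "\<And>T. T \<in> transverse_forms v \<Longrightarrow> form_inner g T S = inner T X"
      using form_inner_represents[OF assms(1,2)] by metis
    then show ?thesis
      using assms by (metis form_inner_commute)
  qed
  then show ?thesis using vector_eq_rdot by blast
qed

text \<open>Resolves the definite description in \<open>form_deriv\<close>: the linear map is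
  encoded as the array \<open>L\<close> of its values on the basis, and \<open>L\<close> is then
  represented by a transverse form.\<close>

lemma
  fixes g :: "'d::finite metric" and v :: "real ^ 'd" and f :: "('q::finite, 'd) tensor \<Rightarrow> real"
  assumes g: "lorentzian g" "unit_timelike g v"
    and U: "openin (top_of_set (transverse_forms v)) U" "B \<in> U"
    and f: "(f has_derivative f') (at B within U)"
  shows form_deriv_in_transverse_forms: "form_deriv g v f B \<in> transverse_forms v"
    and form_inner_form_deriv:
      "h \<in> transverse_forms v \<Longrightarrow> form_inner g h (form_deriv g v f B) = f' h"
proof -
  let ?W = "transverse_forms v :: ('q, 'd) tensor set"
  have fW: "(f has_derivative f') (at B within ?W)"
    using f U by (simp add: at_within_openin)
  have BW: "B \<in> ?W" using U by (auto dest: openin_imp_subset)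
  define L :: "('q, 'd) tensor" where "L = (\<Sum>b\<in>Basis. f' b *\<^sub>R b)"
  have lin: "linear f'" using f has_derivative_linear by blast
  have L: "f' S = inner S L" for S
  proof -
    have "f' S = f' (\<Sum>b\<in>Basis. inner S b *\<^sub>R b)" by (simp add: euclidean_representation)
    also have "\<dots> = inner S L"
      by (simp add: L_def linear_sum[OF lin] linear_scale[OF lin] inner_sum_right mult.commute)
    finally show ?thesis .
  qed
  obtain K where K: "K \<in> ?W" "\<And>S. S \<in> ?W \<Longrightarrow> form_inner g S K = inner S L"
    using form_inner_represents[OF g] by metis
  have bl: "bounded_linear (\<lambda>S. form_inner g S M)" for M :: "('q, 'd) tensor"
    using bounded_linear_form_inner_right[of g M] by (subst form_inner_commute[OF g(1)])
  \<comment> \<open>A derivative within the subspace evaluates its linear map only at differences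
    \<open>y - B\<close>, which are transverse, so agreement with \<open>f'\<close> there
    suffices.\<close>
  have "form_inner g (y - B) K = f' (y - B)" if "y \<in> ?W" for y
    using K(2) L subspace_diff[OF subspace_transverse_forms that BW] by simp
  then have "(f has_derivative (\<lambda>S. form_inner g S K)) (at B within ?W)"
    using fW bl by (simp add: has_derivative_within_alt)
  \<comment> \<open>As linear maps on all arrays, derivatives within the subspace are not unique;
    they are compared along transverse lines only.\<close>
  moreover have "M = K" if M: "M \<in> ?W"
    "(f has_derivative (\<lambda>S. form_inner g S M)) (at B within ?W)" for M
  proof (rule transverse_forms_eqI[OF g M(1) K(1)])
    fix S assume S: "S \<in> ?W"
    obtain e where "e > 0" "\<And>t::real. \<bar>t\<bar> < e \<Longrightarrow> B + t *\<^sub>R S \<in> ?W"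
      by (rule openin_subspace_line[OF subspace_transverse_forms _ BW S]) auto
    then have "form_inner g S M = f' S"
      using has_derivative_within_line[of f _ B 0 S ?W e] M(2) fW by (auto intro: DERIV_unique)
    then show "form_inner g S M = form_inner g S K"
      using K(2)[OF S] L by simp
  qed
  ultimately have "form_deriv g v f B = K"
    unfolding form_deriv_def using K(1) by (blast intro: the_equality)
  then show "form_deriv g v f B \<in> ?W"
    "h \<in> ?W \<Longrightarrow> form_inner g h (form_deriv g v f B) = f' h"
    using K L by auto
qed

subsection \<open>Exchanging derivatives\<close>

text \<open>The parameter interval may contain an end point \<open>s0\<close>, so the derivative in \<open>s\<close> is one-sided.
  As in Peano's form of Schwarz's theorem, existence of the second mixed derivative is a
  conclusion.\<close>

lemma has_real_derivative_exchange:
  fixes \<phi> \<phi>s \<phi>st :: "real \<Rightarrow> real \<Rightarrow> real"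
  assumes I: "is_interval I" "s0 \<in> I" and e: "e > 0"
    and s: "\<And>s t. s \<in> I \<Longrightarrow> \<bar>t\<bar> < e \<Longrightarrow> ((\<lambda>r. \<phi> r t) has_real_derivative \<phi>s s t) (at s within I)"
    and st: "\<And>s t. s \<in> I \<Longrightarrow> \<bar>t\<bar> < e \<Longrightarrow> (\<phi>s s has_real_derivative \<phi>st s t) (at t)"
    and t: "\<And>s. s \<in> I \<Longrightarrow> (\<phi> s has_real_derivative \<phi>t s) (at 0)"
    and cont: "continuous_on (I \<times> {-e<..<e}) (\<lambda>(s, t). \<phi>st s t)"
  shows "(\<phi>t has_real_derivative \<phi>st s0 0) (at s0 within I)"
  unfolding has_field_derivative_def has_derivative_within_alt
proof (intro conjI allI impI)
  fix \<epsilon> :: real assume \<epsilon>: "\<epsilon> > 0"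
  define c where "c = \<phi>st s0 0"
  have "(s0, 0) \<in> I \<times> {-e<..<e}" using I e by auto
  then obtain d0 where d0: "d0 > 0"
    "\<And>s t. s \<in> I \<Longrightarrow> \<bar>t\<bar> < e \<Longrightarrow> dist (s, t) (s0, 0) < d0 \<Longrightarrow> dist (\<phi>st s t) c < \<epsilon>"
    using cont[unfolded continuous_on_iff, rule_format, of "(s0, 0)" \<epsilon>] \<epsilon>
    by (fastforce simp: c_def abs_less_iff)
  \<comment> \<open>Half of \<open>d0\<close>, because the distance in the product is bounded by the
    sum of the two coordinate distances.\<close>
  define d where "d = min (d0 / 2) e"
  have d: "d > 0" "d \<le> e" using d0 e by (auto simp: d_def)
  have bd: "\<bar>\<phi>st s t - c\<bar> \<le> \<epsilon>" if "s \<in> I" "\<bar>s - s0\<bar> < d" "\<bar>t\<bar> < d" for s t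
  proof -
    have "dist (s, t) (s0, 0) \<le> \<bar>s - s0\<bar> + \<bar>t\<bar>"
      using norm_Pair_le[of "s - s0" t] by (simp add: dist_norm)
    also have "\<dots> < d0" using that by (simp add: d_def)
    finally show ?thesis
      using d0(2)[of s t] that d by (auto simp: dist_real_def)
  qed
  \<comment> \<open>Convex even when \<open>s0\<close> is an end point of \<open>I\<close>, as the
    mean value estimate in s requires.\<close>
  define J where "J = I \<inter> {s0 - d<..<s0 + d}"
  have J: "convex J" "s0 \<in> J" "J \<subseteq> I" "\<And>s. s \<in> J \<Longrightarrow> \<bar>s - s0\<bar> < d"
    using I d by (auto simp: J_def is_interval_convex_1 convex_Int)
  \<comment> \<open>Mean value estimate in t, after subtracting the linear term that would be exact
    if the mixed derivative were constantly c.\<close>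
  have 1: "\<bar>\<phi>s s t - \<phi>s s 0 - t * c\<bar> \<le> \<epsilon> * \<bar>t\<bar>" if "s \<in> J" "\<bar>t\<bar> < d" for s t
  proof -
    have "norm ((\<phi>s s t - t * c) - (\<phi>s s 0 - 0 * c)) \<le> \<epsilon> * norm (t - 0)"
    proof (rule field_differentiable_bound[where S="{-d<..<d}" and f'="\<lambda>t. \<phi>st s t - c"])
      fix z assume "z \<in> {-d<..<d}"
      then show "((\<lambda>t. \<phi>s s t - t * c) has_real_derivative \<phi>st s z - c) (at z within {-d<..<d})"
        using J d that st[of s z, THEN has_field_derivative_at_within]
        by (auto intro!: derivative_eq_intros)
    qed (use that J d bd in auto)
    then show ?thesis by (simp add: algebra_simps)
  qed
  \<comment> \<open>A second mean value estimate, now in s, bounds the mixed second difference of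
    \<phi> by a multiple of \<open>\<bar>t\<bar>\<close>.\<close>
  have 2: "\<bar>(\<phi> s t - \<phi> s 0) - (\<phi> s0 t - \<phi> s0 0) - (s - s0) * t * c\<bar> \<le> \<epsilon> * \<bar>t\<bar> * \<bar>s - s0\<bar>"
    if "s \<in> J" "\<bar>t\<bar> < d" for s t
  proof -
    have "norm ((\<phi> s t - \<phi> s 0 - s * (t * c)) - (\<phi> s0 t - \<phi> s0 0 - s0 * (t * c))) \<le> (\<epsilon> * \<bar>t\<bar>) * norm (s - s0)"
    proof (rule field_differentiable_bound[where S=J and f'="\<lambda>s. \<phi>s s t - \<phi>s s 0 - t * c"])
      fix z assume "z \<in> J"
      then show "((\<lambda>s. \<phi> s t - \<phi> s 0 - s * (t * c)) has_real_derivative \<phi>s z t - \<phi>s z 0 - t * c) (at z within J)"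
        using J d e that DERIV_subset[OF s[of z t] J(3)] DERIV_subset[OF s[of z 0] J(3)]
        by (auto intro!: derivative_eq_intros)
    qed (use that J 1 in auto)
    then show ?thesis by (simp add: algebra_simps)
  qed
  \<comment> \<open>That multiple of \<open>\<bar>t\<bar>\<close> survives division by t, and
    letting t tend to 0 turns the quotients into \<open>\<phi>t\<close>.\<close>
  have "\<bar>\<phi>t s - \<phi>t s0 - (s - s0) * c\<bar> \<le> \<epsilon> * \<bar>s - s0\<bar>" if sJ: "s \<in> J" for s
  proof (rule tendsto_upperbound)
    have "((\<lambda>t. (\<phi> s t - \<phi> s 0) / t) \<longlongrightarrow> \<phi>t s) (at 0)" if "s \<in> I" for s
      using t[OF that] by (simp add: DERIV_def)
    then show "((\<lambda>t. \<bar>(\<phi> s t - \<phi> s 0) / t - (\<phi> s0 t - \<phi> s0 0) / t - (s - s0) * c\<bar>)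
        \<longlongrightarrow> \<bar>\<phi>t s - \<phi>t s0 - (s - s0) * c\<bar>) (at 0)"
      using sJ J I by (intro tendsto_intros) auto
    show "\<forall>\<^sub>F t in at 0. \<bar>(\<phi> s t - \<phi> s 0) / t - (\<phi> s0 t - \<phi> s0 0) / t - (s - s0) * c\<bar> \<le> \<epsilon> * \<bar>s - s0\<bar>"
      unfolding eventually_at
    proof (intro exI[of _ d] conjI ballI impI d)
      fix t :: real assume "t \<noteq> 0 \<and> dist t 0 < d"
      then have t: "t \<noteq> 0" "\<bar>t\<bar> < d" by auto
      have "\<bar>(\<phi> s t - \<phi> s 0) / t - (\<phi> s0 t - \<phi> s0 0) / t - (s - s0) * c\<bar> =
          \<bar>(\<phi> s t - \<phi> s 0) - (\<phi> s0 t - \<phi> s0 0) - (s - s0) * t * c\<bar> / \<bar>t\<bar>"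
        using t unfolding abs_divide[symmetric] by (simp add: diff_divide_distrib)
      also have "\<dots> \<le> \<epsilon> * \<bar>s - s0\<bar>"
        using 2[OF sJ t(2)] t by (simp add: field_simps)
      finally show "\<bar>(\<phi> s t - \<phi> s 0) / t - (\<phi> s0 t - \<phi> s0 0) / t - (s - s0) * c\<bar> \<le> \<epsilon> * \<bar>s - s0\<bar>" .
    qed
  qed simp
  then show "\<exists>d>0. \<forall>y\<in>I. norm (y - s0) < d \<longrightarrow>
      norm (\<phi>t y - \<phi>t s0 - \<phi>st s0 0 * (y - s0)) \<le> \<epsilon> * norm (y - s0)"
    using d by (intro exI[of _ d]) (auto simp: J_def c_def mult.commute abs_diff_less_iff)
qed (rule bounded_linear_mult_right)

subsection \<open>The wedge square\<close>

text \<open>Exchanging the blocks only on the slots in \<open>A\<close> makes induction possible: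
  each further slot adds one transposition.\<close>

lemma permutes_sign_block_swap:
  assumes "finite A"
  defines "\<tau> \<equiv> \<lambda>X x. case x of Inl k \<Rightarrow> if k \<in> X then Inr k else Inl k
                        | Inr k \<Rightarrow> if k \<in> X then Inl k else Inr k"
  shows "\<tau> A permutes (UNIV :: ('p::finite + 'p) set) \<and> sign (\<tau> A) = (-1) ^ card A"
  using assms(1)
proof induction
  case empty
  have "\<tau> {} = id" by (auto simp: \<tau>_def fun_eq_iff split: sum.split)
  then show ?case using permutes_id by (simp add: id_def)
next
  case (insert k A)
  have eq: "\<tau> (insert k A) = Transposition.transpose (Inl k) (Inr k) \<circ> \<tau> A"
    using insert by (auto simp: \<tau>_def fun_eq_iff Transposition.transpose_def split: sum.split)
  have sw: "Transposition.transpose (Inl k) (Inr k) permutes (UNIV :: ('p + 'p) set)"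
    by (rule permutes_swap_id) auto
  show ?case
    unfolding eq using insert permutes_compose[OF _ sw]
    by (simp only: sign_compose permutation_UNIV[OF sw] permutation_UNIV sign_swap_id) simp
qed

text \<open>The full block exchange consists of p transpositions, so it has sign 1 for even
  p.\<close>

lemma antisymmetrize_tensor_prod_commute:
  fixes S T :: "('p::finite, 'd::finite) tensor"
  assumes "even CARD('p)"
  shows "antisymmetrize (tensor_prod S T) = antisymmetrize (tensor_prod T S)"
proof -
  let ?\<tau> = "\<lambda>x :: 'p + 'p. case x of Inl k \<Rightarrow> Inr k | Inr k \<Rightarrow> Inl k"
  have "?\<tau> permutes UNIV" "sign ?\<tau> = 1"
    using permutes_sign_block_swap[of "UNIV :: 'p set"] assms by auto
  moreover have "(\<chi> \<mu>. tensor_prod S T $ (\<mu> \<circ> ?\<tau>)) = tensor_prod T S"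
    by (simp add: tensor_prod_def vec_eq_iff o_def)
  ultimately show ?thesis
    using antisymmetrize_permute[of ?\<tau> "tensor_prod S T"] by simp
qed

text \<open>Leibniz rule: each component is a finite signed sum of products of components.\<close>

lemma has_real_derivative_antisymmetrize_tensor_prod:
  fixes X :: "real \<Rightarrow> ('a::finite, 'd::finite) tensor" and Y :: "real \<Rightarrow> ('c::finite, 'd) tensor"
  assumes "\<And>\<mu>. ((\<lambda>r. X r $ \<mu>) has_real_derivative X' $ \<mu>) (at s within I)"
    and "\<And>\<mu>. ((\<lambda>r. Y r $ \<mu>) has_real_derivative Y' $ \<mu>) (at s within I)"
  shows "((\<lambda>r. antisymmetrize (tensor_prod (X r) (Y r)) $ \<mu>) has_real_derivative
     (antisymmetrize (tensor_prod X' (Y s)) + antisymmetrize (tensor_prod (X s) Y')) $ \<mu>)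
     (at s within I)"
proof -
  have "((\<lambda>r. (\<Sum>\<sigma>\<in>A. k \<sigma> * (X r $ a \<sigma> * Y r $ b \<sigma>)) / c) has_real_derivative
      (\<Sum>\<sigma>\<in>A. k \<sigma> * (X' $ a \<sigma> * Y s $ b \<sigma>)) / c + (\<Sum>\<sigma>\<in>A. k \<sigma> * (X s $ a \<sigma> * Y' $ b \<sigma>)) / c)
      (at s within I)" for c k a b and A :: "('a + 'c \<Rightarrow> 'a + 'c) set"
    unfolding add_divide_distrib[symmetric] sum.distrib[symmetric]
    by (rule DERIV_cdivide, rule DERIV_sum)
      (auto intro!: derivative_eq_intros assms simp: algebra_simps)
  then show ?thesis
    by (simp add: antisymmetrize_def tensor_prod_def)
qed

subsection \<open>Dependence on the parameter\<close>

text \<open>A nondegenerate interval has no isolated points; hence derivatives within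
  \<open>I\<close> are unique, end points included.\<close>

lemma at_within_interval_neq_bot:
  fixes I :: "real set"
  assumes "is_interval I" "interior I \<noteq> {}" "s \<in> I"
  shows "at s within I \<noteq> bot"
proof -
  have "I \<noteq> {a}" for a using assms(2) by auto
  then have "s islimpt I"
    using assms by (intro connected_imp_perfect) (auto simp: is_interval_connected_1)
  then show ?thesis by (simp add: trivial_limit_within)
qed

text \<open>\<open>Q\<close> need only agree with \<open>D s\<close> on \<open>U\<close>, so that
  the result covers both a prescribed family and the \<open>vector_derivative\<close> of the
  converse.\<close>

lemma form_deriv_parameter_derivative:
  fixes g :: "'d::finite metric" and v :: "real ^ 'd"
    and H :: "real \<Rightarrow> ('q::finite, 'd) tensor \<Rightarrow> real"
  assumes g: "lorentzian g" "unit_timelike g v"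
    and I: "is_interval I"
    and U: "openin (top_of_set (transverse_forms v)) U"
    and H: "smooth_on (I \<times> U) (\<lambda>(s, B). H s B)"
  obtains D where
    "\<And>s C. s \<in> I \<Longrightarrow> C \<in> U \<Longrightarrow> ((\<lambda>r. H r C) has_real_derivative D s C) (at s within I)"
    and "\<And>s B Q \<mu>. s \<in> I \<Longrightarrow> B \<in> U \<Longrightarrow> \<forall>C\<in>U. Q C = D s C \<Longrightarrow>
      ((\<lambda>r. form_deriv g v (H r) B $ \<mu>) has_real_derivative form_deriv g v Q B $ \<mu>) (at s within I)"
proof -
  let ?W = "transverse_forms v :: ('q, 'd) tensor set"
  let ?f = "\<lambda>(s, B). H s B"
  \<comment> \<open>Order two is enough: only the s-partial is differentiated again, with
    continuity; the other mixed derivative comes out of the exchange lemma.\<close>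
  have "Ck_on (Suc (Suc 0)) (I \<times> U) ?f"
    using H by (simp only: smooth_on_def)
  then obtain f' where f': "\<And>x. x \<in> I \<times> U \<Longrightarrow> (?f has_derivative f' x) (at x within I \<times> U)"
    and f'_smooth: "\<And>w. Ck_on (Suc 0) (I \<times> U) (\<lambda>x. f' x w)"
    unfolding Ck_on.simps(2)[of "Suc 0"] by metis
  obtain f'' where
    f'': "\<And>x. x \<in> I \<times> U \<Longrightarrow> ((\<lambda>x. f' x (1, 0)) has_derivative f'' x) (at x within I \<times> U)"
    and cont: "\<And>w. continuous_on (I \<times> U) (\<lambda>x. f'' x w)"
    using f'_smooth[of "(1, 0)"] by auto
  define D where "D s C = f' (s, C) (1, 0)" for s C
  have dB: "((\<lambda>C. F (s, C)) has_derivative (\<lambda>h. F' (0, h))) (at B within U)"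
    if "s \<in> I" "(F has_derivative F') (at (s, B) within I \<times> U)"
    for F :: "real \<times> ('q, 'd) tensor \<Rightarrow> real" and F' s B
  proof -
    have "((\<lambda>C. (s, C)) has_derivative (\<lambda>h. (0, h))) (at B within U)"
      by (auto intro!: derivative_eq_intros)
    moreover have "(F has_derivative F') (at (s, B) within (\<lambda>C. (s, C)) ` U)"
      by (rule has_derivative_subset[OF that(2)]) (use that in auto)
    ultimately show ?thesis by (rule has_derivative_in_compose)
  qed
  have ds: "((\<lambda>r. H r C) has_real_derivative D s C) (at s within I)" if "s \<in> I" "C \<in> U" for s C
  proof -
    have "((\<lambda>r. (r, C)) has_derivative (\<lambda>h. (h, 0))) (at s within I)"
      by (auto intro!: derivative_eq_intros)
    moreover have "(?f has_derivative f' (s, C)) (at (s, C) within (\<lambda>r. (r, C)) ` I)"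
      by (rule has_derivative_subset[OF f']) (use that in auto)
    ultimately have "((\<lambda>r. ?f (r, C)) has_derivative (\<lambda>h. f' (s, C) (h, 0))) (at s within I)"
      by (rule has_derivative_in_compose)
    moreover have "f' (s, C) (h, 0) = D s C * h" for h
      using linear_scale[OF has_derivative_linear[OF f'[of "(s, C)"]], of h "(1, 0)"] that
      by (simp add: D_def)
    ultimately show ?thesis by (simp add: has_field_derivative_def fun_eq_iff[symmetric])
  qed
  have "((\<lambda>r. form_deriv g v (H r) B $ \<mu>) has_real_derivative form_deriv g v Q B $ \<mu>) (at s within I)"
    if s: "s \<in> I" and B: "B \<in> U" and Q: "\<forall>C\<in>U. Q C = D s C" for s B Q \<mu>
  proof -
    \<comment> \<open>The direction h is dual to the component \<mu>, so the derivative along h is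
      the \<mu>-component of \<open>form_deriv\<close>.\<close>
    obtain h where h: "h \<in> ?W" "\<And>T. T \<in> ?W \<Longrightarrow> form_inner g T h = T $ \<mu>"
      using form_inner_represents[OF g, of "axis \<mu> 1"] by (metis inner_axis inner_real_def mult.right_neutral)
    have dH: "(H r has_derivative (\<lambda>h. f' (r, B) (0, h))) (at B within U)" if "r \<in> I" for r
      using dB[OF that f'] that B by simp
    have "((\<lambda>C. f' (s, C) (1, 0)) has_derivative (\<lambda>h. f'' (s, B) (0, h))) (at B within U)"
      using dB[OF s f''] s B by simp
    then have dQ: "(Q has_derivative (\<lambda>h. f'' (s, B) (0, h))) (at B within U)"
      by (rule has_derivative_transform[rotated 2]) (use B Q in \<open>auto simp: D_def\<close>)
    have component: "form_deriv g v F B $ \<mu> = F' h"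
      if "(F has_derivative F') (at B within U)" for F F'
      using form_deriv_in_transverse_forms[OF g U B that] form_inner_form_deriv[OF g U B that h(1)] h(2)
      by (metis form_inner_commute[OF g(1)])
    obtain e where e: "e > 0" "\<And>t::real. \<bar>t\<bar> < e \<Longrightarrow> B + t *\<^sub>R h \<in> U"
      using openin_subspace_line[OF subspace_transverse_forms U B h(1)] by metis
    have line: "((\<lambda>t. F (r, B + t *\<^sub>R h)) has_real_derivative F' (0, h)) (at t)"
      if "r \<in> I" "\<bar>t\<bar> < e" "(F has_derivative F') (at (r, B + t *\<^sub>R h) within I \<times> U)"
      for F :: "real \<times> ('q, 'd) tensor \<Rightarrow> real" and F' r t
      using has_derivative_within_line[of F F' "(r, B)" t "(0, h)" "I \<times> U" e] that e by simp
    \<comment> \<open>Exchange along the segment through \<open>B\<close> in direction h; the term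
      \<open>0 *\<^sub>R h\<close> is the point t = 0.\<close>
    have "((\<lambda>r. f' (r, B) (0, h)) has_real_derivative f'' (s, B + 0 *\<^sub>R h) (0, h)) (at s within I)"
    proof (rule has_real_derivative_exchange[where e=e and \<phi>="\<lambda>r t. H r (B + t *\<^sub>R h)"
          and \<phi>s="\<lambda>r t. D r (B + t *\<^sub>R h)" and \<phi>st="\<lambda>r t. f'' (r, B + t *\<^sub>R h) (0, h)"])
      have "continuous_on (I \<times> {-e<..<e}) (\<lambda>x. (fst x, B + snd x *\<^sub>R h))"
        by (intro continuous_intros)
      then have "continuous_on (I \<times> {-e<..<e}) ((\<lambda>x. f'' x (0, h)) \<circ> (\<lambda>x. (fst x, B + snd x *\<^sub>R h)))"
        by (rule continuous_on_compose)
          (rule continuous_on_subset[OF cont], use e in \<open>auto simp: abs_less_iff\<close>)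
      then show "continuous_on (I \<times> {-e<..<e}) (\<lambda>(r, t). f'' (r, B + t *\<^sub>R h) (0, h))"
        by (simp add: o_def case_prod_unfold)
    qed (use I s e ds line[OF _ _ f'] line[OF _ _ f''] line[OF _ _ f', of _ 0] B in \<open>auto simp: D_def\<close>)
    then have "((\<lambda>r. f' (r, B) (0, h)) has_real_derivative form_deriv g v Q B $ \<mu>) (at s within I)"
      by (simp add: component[OF dQ])
    then show ?thesis
      by (rule has_field_derivative_transform_within[OF _ zero_less_one s]) (simp add: component[OF dH])
  qed
  then show thesis using that ds by blast
qed

section \<open>Preservation of the quadratic equation and its converse\<close>

theorem mainTheorem12:
  fixes n :: nat
    and g :: "'d::finite metric"
    and v :: "real ^ 'd"
    and I :: "real set"
    and U :: "('p::finite, 'd) tensor set"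
    and H :: "real \<Rightarrow> ('p, 'd) tensor \<Rightarrow> real"
  assumes "n \<ge> 1"
    and "CARD('p) = 2 * n"
    and "CARD('d) = 2 * CARD('p) + 2"
    and "lorentzian g"
    and "unit_timelike g v"
    and "is_interval I" and "0 \<in> I" and "interior I \<noteq> {}"
    and "openin (top_of_set (transverse_forms v)) U"
    and "smooth_scalar_family g I U H"
  shows
    "(\<forall>Q :: real \<Rightarrow> ('p, 'd) tensor \<Rightarrow> real.
        smooth_scalar_family g I U Q \<longrightarrow>
        (\<forall>s\<in>I. \<forall>B\<in>U. ((\<lambda>r. H r B) has_real_derivative Q s B) (at s within I)) \<longrightarrow>
        (\<forall>s\<in>I. \<forall>B\<in>U.
            antisymmetrize (tensor_prod (form_deriv g v (Q s) B) (form_deriv g v (H s) B)) = 0) \<longrightarrow>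
        (\<forall>B\<in>U. antisymmetrize (tensor_prod (form_deriv g v (H 0) B) (form_deriv g v (H 0) B))
               = antisymmetrize (tensor_prod B B)) \<longrightarrow>
        (\<forall>s\<in>I. \<forall>B\<in>U. antisymmetrize (tensor_prod (form_deriv g v (H s) B) (form_deriv g v (H s) B))
               = antisymmetrize (tensor_prod B B)))
   \<and> ((\<forall>s\<in>I. \<forall>B\<in>U. antisymmetrize (tensor_prod (form_deriv g v (H s) B) (form_deriv g v (H s) B))
               = antisymmetrize (tensor_prod B B)) \<longrightarrow>
      (\<forall>s\<in>I. \<forall>B\<in>U.
          antisymmetrize (tensor_prod
            (form_deriv g v (\<lambda>C. vector_derivative (\<lambda>r. H r C) (at s within I)) B)
            (form_deriv g v (H s) B)) = 0))"
proof -
  note g = assms(4,5) and I = assms(6) and U = assms(9)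
  have even: "even CARD('p)" using assms(2) by simp
  have nt: "at s within I \<noteq> bot" if "s \<in> I" for s
    using at_within_interval_neq_bot[OF I assms(8) that] .
  obtain D where
    D: "\<And>s C. s \<in> I \<Longrightarrow> C \<in> U \<Longrightarrow> ((\<lambda>r. H r C) has_real_derivative D s C) (at s within I)"
    and K: "\<And>s B Q \<mu>. s \<in> I \<Longrightarrow> B \<in> U \<Longrightarrow> \<forall>C\<in>U. Q C = D s C \<Longrightarrow>
      ((\<lambda>r. form_deriv g v (H r) B $ \<mu>) has_real_derivative form_deriv g v Q B $ \<mu>) (at s within I)"
  proof (rule form_deriv_parameter_derivative[OF g I U])
    show "smooth_on (I \<times> U) (\<lambda>(s, B). H s B)"
      using assms(10) by (simp add: smooth_scalar_family_def)
  qed (rule that)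
  \<comment> \<open>Identifies any prescribed parameter derivative of \<open>H\<close> with
    \<open>D\<close>, to which the commutation result refers.\<close>
  have D_eq: "D s C = y"
    if "s \<in> I" "C \<in> U" "((\<lambda>r. H r C) has_real_derivative y) (at s within I)" for s C y
    using that D[OF that(1,2)] nt[OF that(1)]
    by (metis has_real_derivative_iff_has_vector_derivative vector_derivative_within)
  define \<Phi> where "\<Phi> B r = antisymmetrize (tensor_prod (form_deriv g v (H r) B) (form_deriv g v (H r) B))"
    for B r
  have \<Phi>': "((\<lambda>r. \<Phi> B r $ \<mu>) has_real_derivative
      2 * antisymmetrize (tensor_prod (form_deriv g v Q B) (form_deriv g v (H s) B)) $ \<mu>) (at s within I)"
    if "s \<in> I" "B \<in> U" "\<forall>C\<in>U. Q C = D s C" for s B Q \<mu>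
    using has_real_derivative_antisymmetrize_tensor_prod[OF K[OF that] K[OF that], of \<mu>]
    unfolding antisymmetrize_tensor_prod_commute[OF even, of "form_deriv g v (H s) B" "form_deriv g v Q B"]
    by (simp add: \<Phi>_def)
  show ?thesis
    unfolding \<Phi>_def[symmetric]
  proof (intro conjI allI impI ballI)
    fix Q s B
    assume Q: "\<forall>s\<in>I. \<forall>B\<in>U. ((\<lambda>r. H r B) has_real_derivative Q s B) (at s within I)"
      and zero: "\<forall>s\<in>I. \<forall>B\<in>U.
        antisymmetrize (tensor_prod (form_deriv g v (Q s) B) (form_deriv g v (H s) B)) = 0"
      and init: "\<forall>B\<in>U. \<Phi> B 0 = antisymmetrize (tensor_prod B B)"
      and s: "s \<in> I" and B: "B \<in> U"
    have "((\<lambda>r. \<Phi> B r $ \<mu>) has_real_derivative 0) (at r within I)" if "r \<in> I" for r \<mu>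
    proof -
      have "\<forall>C\<in>U. Q r C = D r C" using D_eq[OF that] Q that by metis
      from \<Phi>'[OF that B this, of \<mu>] show ?thesis using zero that B by simp
    qed
    \<comment> \<open>A vanishing derivative within the convex set \<open>I\<close> gives constancy;
      this is applied to each component of the array.\<close>
    then have "\<Phi> B s $ \<mu> = \<Phi> B 0 $ \<mu>" for \<mu>
      using has_field_derivative_zero_constant[of I "\<lambda>r. \<Phi> B r $ \<mu>"] I s assms(7)
      by (metis is_interval_convex)
    then show "\<Phi> B s = antisymmetrize (tensor_prod B B)"
      using init B by (simp add: vec_eq_iff)
  next
    fix s B
    assume const: "\<forall>s\<in>I. \<forall>B\<in>U. \<Phi> B s = antisymmetrize (tensor_prod B B)"
      and s: "s \<in> I" and B: "B \<in> U"
    let ?Q = "\<lambda>C. vector_derivative (\<lambda>r. H r C) (at s within I)"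
    have "\<forall>C\<in>U. ?Q C = D s C"
      using D[OF s] nt[OF s]
      by (simp add: has_real_derivative_iff_has_vector_derivative vector_derivative_within)
    note deriv = \<Phi>'[OF s B this]
    \<comment> \<open>Constancy on \<open>I\<close> gives the value 0 for a derivative that
      \<open>deriv\<close> has already computed; uniqueness within \<open>I\<close> equates the
      two.\<close>
    have deriv0: "((\<lambda>r. \<Phi> B r $ \<mu>) has_real_derivative 0) (at s within I)" for \<mu>
      by (rule has_field_derivative_transform_within[OF DERIV_const[of "\<Phi> B s $ \<mu>"] zero_less_one s])
        (use const s B in auto)
    have "2 * antisymmetrize (tensor_prod (form_deriv g v ?Q B) (form_deriv g v (H s) B)) $ \<mu> = 0" for \<mu>
      using deriv[of \<mu>, THEN has_real_derivative_iff_has_vector_derivative[THEN iffD1],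
          THEN vector_derivative_within[OF nt[OF s]]]
        deriv0[of \<mu>, THEN has_real_derivative_iff_has_vector_derivative[THEN iffD1],
          THEN vector_derivative_within[OF nt[OF s]]]
      by simp
    then show "antisymmetrize (tensor_prod (form_deriv g v ?Q B) (form_deriv g v (H s) B)) = 0"
      by (simp add: vec_eq_iff)
  qed
qed

end
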